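(* Let $E$ and $F$ be types, let $K, L$ be simplicial complexes over $E$ and $Z, W$ simplicial complexes over $F$ such that $K \cong Z$ and $L \cong W$. Suppose there is an injective function $f : E \to F$. If $K \cong_{\mathrm{st}} L$ (stellar equivalence over $E$), then $Z \cong_{\mathrm{st}} W$ (stellar equivalence over $F$).
   Context: A simplicial complex over a type (set) $E$ is a set $K$ of nonempty finite subsets of $E$ (its faces) such that every nonempty subset of a face is a face. It may be empty or infinite, and not every element of $E$ need be a vertex. $V(K) = \{x \in E \mid \{x\} \in K\}$. For a finite set $s \subseteq E$: $\mathrm{Lk}(K,s) = \{t \in K \mid s \cup t \in K,\ s \cap t = \emptyset\}$; $\partial s = \{t \subseteq s \mid t \ne \emptyset,\ t \neq s\}$. A simplicial map from $K$ (over $E$) to $L$ (over $F$) is a function $E \to F$ sending each face of $K$ to a face of $L$. $K \cong L$ (isomorphism) means there are simplicial maps $f : E \to F$ from $K$ to $L$ and $g : F \to E$ from $L$ to $K$ with $g(f(x)) = x$ for all $x \in V(K)$ and $f(g(y)) = y$ for all $y \in V(L)$. For $s \in K$ and $x \in E \setminus V(K)$, the stellar subdivision $\sigma_s K$ of $K$ at $s$ with barycenter $x$ is the complex over $E$ whose faces are the faces of $K$ not containing $s$ together with all nonempty sets $a \cup b \cup c$ with $a \in \mathrm{Lk}(K,s) \cup \{\emptyset\}$, $b \in \partial s \cup \{\emptyset\}$, $c \in \{\emptyset, \{x\}\}$. For complexes $K, L$ over the same type $E$, there is a stellar move from $K$ to $L$ if $L$ is a stellar subdivision of $K$ (for some face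 $s$ of $K$ and some barycenter in $E \setminus V(K)$), or $K$ is a stellar subdivision of $L$ (a stellar weld), or $K \cong L$. Stellar equivalence $\cong_{\mathrm{st}}$ is the reflexive transitive closure of the stellar move relation on complexes over $E$. *)

theory Defs
  imports Main
begin

text \<open>
  A complex is represented by its set of faces. Vertices are not required to exhaust the
  ambient type, and the set of faces may be empty or infinite.
\<close>

definition abstract_simplicial_complex :: "'a set set \<Rightarrow> bool" where
  "abstract_simplicial_complex K \<longleftrightarrow>
     (\<forall>s\<in>K. finite s \<and> s \<noteq> {}) \<and>
     (\<forall>s\<in>K. \<forall>t. t \<subseteq> s \<and> t \<noteq> {} \<longrightarrow> t \<in> K)"

definition vertices :: "'a set set \<Rightarrow> 'a set" where
  "vertices K = {x. {x} \<in> K}"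

definition link :: "'a set set \<Rightarrow> 'a set \<Rightarrow> 'a set set" where
  "link K s = {t \<in> K. s \<union> t \<in> K \<and> s \<inter> t = {}}"

definition simplex_boundary :: "'a set \<Rightarrow> 'a set set" where
  "simplex_boundary s = {t. t \<subseteq> s \<and> t \<noteq> {} \<and> t \<noteq> s}"

definition simplicial_map :: "'a set set \<Rightarrow> 'b set set \<Rightarrow> ('a \<Rightarrow> 'b) \<Rightarrow> bool" where
  "simplicial_map K L f \<longleftrightarrow> (\<forall>s\<in>K. f ` s \<in> L)"

definition complex_iso :: "'a set set \<Rightarrow> 'b set set \<Rightarrow> bool" where
  "complex_iso K L \<longleftrightarrow>
     (\<exists>f g. simplicial_map K L f \<and> simplicial_map L K g \<and>
        (\<forall>x\<in>vertices K. g (f x) = x) \<and> (\<forall>y\<in>vertices L. f (g y) = y))"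

definition stellar_subdivision :: "'a set set \<Rightarrow> 'a set \<Rightarrow> 'a \<Rightarrow> 'a set set" where
  "stellar_subdivision K s x =
     {t \<in> K. \<not> s \<subseteq> t} \<union>
     {a \<union> b \<union> c | a b c.
        a \<in> link K s \<union> {{}} \<and> b \<in> simplex_boundary s \<union> {{}} \<and> c \<in> {{}, {x}} \<and>
        a \<union> b \<union> c \<noteq> {}}"

definition is_stellar_subdivision :: "'a set set \<Rightarrow> 'a set set \<Rightarrow> bool" where
  "is_stellar_subdivision K L \<longleftrightarrow>
     (\<exists>s x. s \<in> K \<and> x \<notin> vertices K \<and> L = stellar_subdivision K s x)"

definition stellar_move :: "'a set set \<Rightarrow> 'a set set \<Rightarrow> bool" where
  "stellar_move K L \<longleftrightarrow>
     abstract_simplicial_complex K \<and> abstract_simplicial_complex L \<and>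
     (is_stellar_subdivision K L \<or> is_stellar_subdivision L K \<or> complex_iso K L)"

text \<open>
  On sets of faces that do not form a complex this relation is just equality, so on complexes
  it is the reflexive transitive closure of the move relation restricted to complexes.
\<close>

definition stellar_equiv :: "'a set set \<Rightarrow> 'a set set \<Rightarrow> bool" where
  "stellar_equiv = stellar_move\<^sup>*\<^sup>*"

lemma abstract_simplicial_complex_stellar_subdivision:
  assumes K: "abstract_simplicial_complex K" and s: "s \<in> K"
  shows "abstract_simplicial_complex (stellar_subdivision K s x)"
proof -
  have fin: "finite u" "u \<noteq> {}" if "u \<in> K" for u
    using K that unfolding abstract_simplicial_complex_def by blast+
  have sub: "t \<in> K" if "u \<in> K" "t \<subseteq> u" "t \<noteq> {}" for t u
    using K that unfolding abstract_simplicial_complex_def by blast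
  have link_sub: "t \<in> link K s \<union> {{}}" if "a \<in> link K s \<union> {{}}" "t \<subseteq> a" for t a
  proof (cases "t = {}")
    case False
    then have a: "a \<in> K" "s \<union> a \<in> K" "s \<inter> a = {}"
      using that by (auto simp: link_def)
    have "s \<union> t \<in> K" using sub[OF a(2), of "s \<union> t"] that False by blast
    moreover have "t \<in> K" using sub[OF a(1)] that False by blast
    ultimately show ?thesis using a that by (auto simp: link_def)
  qed simp
  have bd_sub: "t \<in> simplex_boundary s \<union> {{}}"
    if "b \<in> simplex_boundary s \<union> {{}}" "t \<subseteq> b" for t b
  proof (cases "b = {}")
    case False
    then have "b \<subset> s" using that(1) by (simp add: simplex_boundary_def psubset_eq)
    then have "t \<subset> s" using that(2) by (rule subset_psubset_trans[rotated])
    then show ?thesis by (simp add: simplex_boundary_def psubset_eq)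
  qed (use that(2) in simp)
  have join_in: "a \<union> b \<union> c \<in> stellar_subdivision K s x"
    if "a \<in> link K s \<union> {{}}" "b \<in> simplex_boundary s \<union> {{}}" "c \<in> {{}, {x}}"
      "a \<union> b \<union> c \<noteq> {}" for a b c
    unfolding stellar_subdivision_def
    by (rule UnI2, rule CollectI, intro exI[of _ a] exI[of _ b] exI[of _ c])
      (simp only: that simp_thms)
  have mem: "u \<in> stellar_subdivision K s x \<longleftrightarrow> (u \<in> K \<and> \<not> s \<subseteq> u) \<or>
      (\<exists>a b c. u = a \<union> b \<union> c \<and> a \<in> link K s \<union> {{}} \<and> b \<in> simplex_boundary s \<union> {{}} \<and>
        c \<in> {{}, {x}} \<and> a \<union> b \<union> c \<noteq> {})" for u
    by (simp only: stellar_subdivision_def Un_iff mem_Collect_eq)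
  show ?thesis
    unfolding abstract_simplicial_complex_def
  proof (intro conjI ballI allI impI)
    fix u assume u: "u \<in> stellar_subdivision K s x"
    show "u \<noteq> {}" using u[unfolded mem] fin(2) by (elim disjE conjE exE) simp_all
    from u[unfolded mem] consider "u \<in> K"
      | a b c where "u = a \<union> b \<union> c" "a \<in> link K s \<union> {{}}"
          "b \<in> simplex_boundary s \<union> {{}}" "c \<in> {{}, {x}}"
      by (elim disjE conjE exE) simp_all
    then show "finite u"
    proof cases
      case 1
      then show ?thesis by (rule fin(1))
    next
      case 2
      have "finite a" using 2(2) fin(1) unfolding link_def by blast
      moreover have "finite b"
        using 2(3) finite_subset[OF _ fin(1)[OF s], of b] unfolding simplex_boundary_def by blast
      moreover have "finite c" using 2(4) by auto
      ultimately show ?thesis using 2(1) by simp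
    qed
  next
    fix u t assume u: "u \<in> stellar_subdivision K s x" and t: "t \<subseteq> u \<and> t \<noteq> {}"
    from u[unfolded mem] consider "u \<in> K" "\<not> s \<subseteq> u"
      | a b c where "u = a \<union> b \<union> c" "a \<in> link K s \<union> {{}}"
          "b \<in> simplex_boundary s \<union> {{}}" "c \<in> {{}, {x}}"
      by (elim disjE conjE exE) simp_all
    then show "t \<in> stellar_subdivision K s x"
    proof cases
      case 1
      then show ?thesis using sub[OF 1(1), of t] t
        by (simp add: stellar_subdivision_def) (meson order_trans)
    next
      case 2
      have eq: "(t \<inter> a) \<union> (t \<inter> b) \<union> (t \<inter> c) = t" using 2(1) t by blast
      have "t \<inter> a \<in> link K s \<union> {{}}" by (rule link_sub[OF 2(2)]) simp
      moreover have "t \<inter> b \<in> simplex_boundary s \<union> {{}}" by (rule bd_sub[OF 2(3)]) simp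
      moreover have "t \<inter> c \<in> {{}, {x}}" using 2(4) by auto
      moreover have "(t \<inter> a) \<union> (t \<inter> b) \<union> (t \<inter> c) \<noteq> {}" using eq t by simp
      ultimately have "(t \<inter> a) \<union> (t \<inter> b) \<union> (t \<inter> c) \<in> stellar_subdivision K s x"
        by (rule join_in)
      then show ?thesis unfolding eq .
    qed
  qed
qed

end

theory Submission
  imports Defs
begin

text \<open>
  An injective \<open>f\<close> carries every complex over \<open>'e\<close> to an isomorphic complex over \<open>'f\<close> and
  commutes with stellar subdivision, so it transports a chain of stellar moves from \<open>K\<close> to \<open>L\<close>
  to a chain between their images. Isomorphisms at both ends, which are themselves moves, connect
  this chain to \<open>Z\<close> and \<open>W\<close>.
\<close>

lemma complex_iso_sym: "complex_iso K L \<Longrightarrow> complex_iso L K"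
  unfolding complex_iso_def by blast

lemma simplicial_map_vertices:
  "simplicial_map K L f \<Longrightarrow> x \<in> vertices K \<Longrightarrow> f x \<in> vertices L"
  by (force simp: simplicial_map_def vertices_def)

lemma simplicial_map_comp:
  "simplicial_map K L f \<Longrightarrow> simplicial_map L M g \<Longrightarrow> simplicial_map K M (g \<circ> f)"
  unfolding simplicial_map_def by (metis image_comp)

text \<open>The maps of an isomorphism are mutually inverse only on vertices. Since simplicial maps
  send vertices to vertices, the inner pair of maps is evaluated at a vertex of \<open>L\<close> and
  cancels.\<close>

lemma complex_iso_trans:
  assumes "complex_iso K L" and "complex_iso L M"
  shows "complex_iso K M"
proof -
  obtain f g where fg: "simplicial_map K L f" "simplicial_map L K g"
    "\<forall>x\<in>vertices K. g (f x) = x" "\<forall>y\<in>vertices L. f (g y) = y"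
    using assms(1) unfolding complex_iso_def by blast
  obtain f' g' where fg': "simplicial_map L M f'" "simplicial_map M L g'"
    "\<forall>x\<in>vertices L. g' (f' x) = x" "\<forall>y\<in>vertices M. f' (g' y) = y"
    using assms(2) unfolding complex_iso_def by blast
  show ?thesis
    unfolding complex_iso_def
  proof (intro exI conjI)
    show "simplicial_map K M (f' \<circ> f)" "simplicial_map M K (g \<circ> g')"
      using fg fg' by (blast intro: simplicial_map_comp)+
    show "\<forall>x\<in>vertices K. (g \<circ> g') ((f' \<circ> f) x) = x"
      "\<forall>y\<in>vertices M. (f' \<circ> f) ((g \<circ> g') y) = y"
      using fg fg' by (simp_all add: simplicial_map_vertices)
  qed
qed

lemma image_mem_image_image_iff: "inj f \<Longrightarrow> f ` s \<in> (`) f ` K \<longleftrightarrow> s \<in> K"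
  by (auto simp: inj_image_eq_iff)

lemma vertices_image: "inj f \<Longrightarrow> vertices ((`) f ` K) = f ` vertices K"
proof -
  assume f: "inj f"
  \<comment> \<open>Vertices of the image lie in \<open>range f\<close>, so it suffices to compare
    both sides at points \<open>f x\<close>.\<close>
  have "y \<in> range f" if "{y} = f ` s" for y s
    using that by blast
  then have "vertices ((`) f ` K) \<subseteq> range f"
    by (auto simp: vertices_def)
  moreover have "f x \<in> vertices ((`) f ` K) \<longleftrightarrow> x \<in> vertices K" for x
    using image_mem_image_image_iff [OF f, of "{x}" K] by (simp add: vertices_def)
  ultimately show ?thesis by blast
qed

lemma complex_iso_image:
  assumes "inj f"
  shows "complex_iso K ((`) f ` K)"
  unfolding complex_iso_def
proof (intro exI conjI)
  \<comment> \<open>The arbitrary values of \<open>inv f\<close> outside \<open>range f\<close> do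
    no harm: every face of the image complex lies in \<open>range f\<close>.\<close>
  show "simplicial_map K ((`) f ` K) f" "simplicial_map ((`) f ` K) K (inv f)"
    using assms by (auto simp: simplicial_map_def image_comp)
  show "\<forall>x\<in>vertices K. inv f (f x) = x" "\<forall>y\<in>vertices ((`) f ` K). f (inv f y) = y"
    using assms by (auto simp: vertices_image)
qed

lemma abstract_simplicial_complex_image:
  assumes "abstract_simplicial_complex K"
  shows "abstract_simplicial_complex ((`) f ` K)"
  unfolding abstract_simplicial_complex_def
proof (intro conjI ballI allI impI)
  fix s assume "s \<in> (`) f ` K"
  then show "finite s" "s \<noteq> {}"
    using assms by (auto simp: abstract_simplicial_complex_def)
next
  fix s t assume "s \<in> (`) f ` K" and t: "t \<subseteq> s \<and> t \<noteq> {}"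
  then obtain u where u: "u \<in> K" "s = f ` u"
    by blast
  with t obtain v where v: "v \<subseteq> u" "t = f ` v"
    by (auto simp: subset_image_iff)
  with t have "v \<noteq> {}" by simp
  with assms u(1) v(1) have "v \<in> K"
    unfolding abstract_simplicial_complex_def by blast
  with v(2) show "t \<in> (`) f ` K" by simp
qed

lemma link_image:
  assumes "inj f"
  shows "link ((`) f ` K) (f ` s) = (`) f ` link K s"
proof -
  have "f ` t \<in> link ((`) f ` K) (f ` s) \<longleftrightarrow> t \<in> link K s" for t
    using assms
    by (simp add: link_def image_mem_image_image_iff image_Un [symmetric] image_Int [symmetric])
  moreover have "link ((`) f ` K) (f ` s) \<subseteq> range ((`) f)"
    by (auto simp: link_def)
  ultimately show ?thesis by blast
qed

lemma simplex_boundary_image: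
  assumes "inj f"
  shows "simplex_boundary (f ` s) = (`) f ` simplex_boundary s"
  using assms by (auto simp: simplex_boundary_def subset_image_iff inj_image_eq_iff)

lemma stellar_subdivision_image:
  assumes "inj f"
  shows "stellar_subdivision ((`) f ` K) (f ` s) (f x) = (`) f ` stellar_subdivision K s x"
proof -
  have faces: "{t \<in> (`) f ` K. \<not> f ` s \<subseteq> t} = (`) f ` {t \<in> K. \<not> s \<subseteq> t}"
    using assms by (auto simp: inj_image_subset_iff)
  \<comment> \<open>Bounded quantifiers let each of the three ranges be replaced by its image
    separately.\<close>
  have join_eq: "{a \<union> b \<union> c | a b c. a \<in> A \<and> b \<in> B \<and> c \<in> C \<and> a \<union> b \<union> c \<noteq> {}}
      = {w. w \<noteq> {} \<and> (\<exists>a\<in>A. \<exists>b\<in>B. \<exists>c\<in>C. w = a \<union> b \<union> c)}" for A B C :: "'c set set"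
    by (intro set_eqI, simp only: mem_Collect_eq) metis
  \<comment> \<open>Taking images preserves unions and reflects emptiness, so it commutes with
    forming nonempty joins.\<close>
  have joins: "{w. w \<noteq> {} \<and> (\<exists>a\<in>(`) f ` A. \<exists>b\<in>(`) f ` B. \<exists>c\<in>(`) f ` C. w = a \<union> b \<union> c)}
      = (`) f ` {w. w \<noteq> {} \<and> (\<exists>a\<in>A. \<exists>b\<in>B. \<exists>c\<in>C. w = a \<union> b \<union> c)}" for A B C
  proof -
    have "w \<noteq> {} \<and> (\<exists>a\<in>(`) f ` A. \<exists>b\<in>(`) f ` B. \<exists>c\<in>(`) f ` C. w = a \<union> b \<union> c) \<longleftrightarrow>
        (\<exists>v. w = f ` v \<and> v \<noteq> {} \<and> (\<exists>a\<in>A. \<exists>b\<in>B. \<exists>c\<in>C. v = a \<union> b \<union> c))" for w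
      by (simp only: bex_simps image_Un [symmetric]) (metis image_is_empty)
    then show ?thesis by (simp only: image_def [of "(`) f"] mem_Collect_eq Bex_def) metis
  qed
  have parts: "link ((`) f ` K) (f ` s) \<union> {{}} = (`) f ` (link K s \<union> {{}})"
    "simplex_boundary (f ` s) \<union> {{}} = (`) f ` (simplex_boundary s \<union> {{}})"
    "{{}, {f x}} = (`) f ` {{}, {x}}"
    using assms by (simp_all add: link_image simplex_boundary_image)
  show ?thesis
    unfolding stellar_subdivision_def join_eq
    by (simp only: parts faces joins image_Un [of _ "{t \<in> K. \<not> s \<subseteq> t}"])
qed

lemma stellar_move_image:
  assumes "inj f" and "stellar_move K L"
  shows "stellar_move ((`) f ` K) ((`) f ` L)"
proof -
  \<comment> \<open>Stated for arbitrary \<open>A\<close> and \<open>B\<close> to serve both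
    subdivisions and welds. Injectivity keeps the new barycenter \<open>f x\<close> off the vertices
    of the image.\<close>
  have sub: "is_stellar_subdivision ((`) f ` A) ((`) f ` B)" if AB: "is_stellar_subdivision A B" for A B
  proof -
    obtain s x where "s \<in> A" "x \<notin> vertices A" "B = stellar_subdivision A s x"
      using AB unfolding is_stellar_subdivision_def by blast
    with assms(1) have "f ` s \<in> (`) f ` A" "f x \<notin> vertices ((`) f ` A)"
      "(`) f ` B = stellar_subdivision ((`) f ` A) (f ` s) (f x)"
      by (simp_all add: vertices_image image_mem_image_image_iff inj_image_mem_iff
          stellar_subdivision_image)
    then show ?thesis unfolding is_stellar_subdivision_def by blast
  qed
  \<comment> \<open>Go back from the image of \<open>K\<close> to \<open>K\<close>, across to
    \<open>L\<close>, and forward to the image of \<open>L\<close>.\<close>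
  have iso: "complex_iso ((`) f ` K) ((`) f ` L)" if "complex_iso K L"
    by (rule complex_iso_trans [OF complex_iso_trans
          [OF complex_iso_sym [OF complex_iso_image [OF assms(1)]] that] complex_iso_image [OF assms(1)]])
  show ?thesis
    using assms(2) sub iso unfolding stellar_move_def
    by (blast intro: abstract_simplicial_complex_image)
qed

lemma stellar_equiv_image:
  assumes "inj f" and "stellar_equiv K L"
  shows "stellar_equiv ((`) f ` K) ((`) f ` L)"
  using assms(2) unfolding stellar_equiv_def
proof induction
  case (step L M)
  from step.IH stellar_move_image [OF assms(1) step.hyps(2)] show ?case
    by (rule rtranclp.rtrancl_into_rtrancl)
qed simp

theorem theorem3p2:
  fixes K L :: "'e set set" and Z W :: "'f set set" and f :: "'e \<Rightarrow> 'f"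
  assumes "abstract_simplicial_complex K" and "abstract_simplicial_complex L"
    and "abstract_simplicial_complex Z" and "abstract_simplicial_complex W"
    and "complex_iso K Z" and "complex_iso L W"
    and "inj f"
    and "stellar_equiv K L"
  shows "stellar_equiv Z W"
proof -
  have "complex_iso Z ((`) f ` K)"
    by (rule complex_iso_trans [OF complex_iso_sym [OF assms(5)] complex_iso_image [OF assms(7)]])
  moreover have "complex_iso ((`) f ` L) W"
    by (rule complex_iso_trans [OF complex_iso_sym [OF complex_iso_image [OF assms(7)]] assms(6)])
  \<comment> \<open>Both isomorphisms now join complexes over \<open>'f\<close>, so they count as
    moves and can be attached to the two ends of the transported chain.\<close>
  ultimately have "stellar_move Z ((`) f ` K)" "stellar_move ((`) f ` L) W"
    using assms(1-4) by (simp_all add: stellar_move_def abstract_simplicial_complex_image)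
  with stellar_equiv_image [OF assms(7,8)] show ?thesis
    unfolding stellar_equiv_def
    by (meson converse_rtranclp_into_rtranclp rtranclp.rtrancl_into_rtrancl)
qed

end
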